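(* Let $\lambda_{\rm cr}=\inf\{\lambda\ge 0:\lambda\,\zeta(\mathrm{Poi}(\lambda))=2\}$. For any $\lambda>\lambda_{\rm cr}$ there exists a constant $\alpha_{\rm cr}>1$ such that, with $p_\alpha=\mathrm{MPoi}(\mathrm{Par}(\alpha,c_\alpha))$ and $c_\alpha=\lambda(1-1/\alpha)$ for $\alpha>1$, \[ \zeta_{\rm CM}(p_\alpha)\le \zeta_{\rm CM}(p_\beta)\le \zeta_{\rm CM}(\mathrm{Poi}(\lambda)) \] for all $\alpha_{\rm cr}\le\alpha\le\beta$.
   Context: For a probability distribution $p$ on $\mathbb{Z}_+=\{0,1,2,\dots\}$ (the same symbol denotes its probability mass function), $G_p(s)=\sum_{k\ge 0}s^k p(k)$, $s\in[0,1]$, is its generating function, $\eta(p)=\inf\{s\ge 0: G_p(s)=s\}$ is the smallest fixed point of $G_p$ in $[0,1]$ (the extinction probability of a Galton--Watson process with offspring distribution $p$), and $\zeta(p)=1-\eta(p)$. If $p$ has finite nonzero mean $m_1(p)=\sum_k k\,p(k)$, its downshifted size biasing is the probability distribution $p^\circ$ on $\mathbb{Z}_+$ given by $p^\circ(k)=\frac{(k+1)p(k+1)}{m_1(p)}$, and $\zeta_{\rm CM}(p)=1-G_p(\eta(p^\circ))$. $\mathrm{Poi}(\lambda)$ is the Poisson distribution with mean $\lambda$. $\mathrm{Par}(\alpha,c)$ is the Pareto distribution with shape $\alpha>1$ and scale $c>0$, having density $f(t)=\alpha c^\alpha t^{-\alpha-1}$ for $t>c$ (and $0$ otherwise). For a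 probability distribution $\mu$ on $\mathbb{R}_+$, $\mathrm{MPoi}(\mu)$ is the $\mu$-mixed Poisson distribution on $\mathbb{Z}_+$ with probability mass function $k\mapsto\int_{\mathbb{R}_+}e^{-x}\frac{x^k}{k!}\,\mu(dx)$. With the choice $c_\alpha=\lambda(1-1/\alpha)$, the mean of $p_\alpha$ equals $\lambda$ for every $\alpha>1$. *)

theory Defs
  imports "HOL-Probability.Probability"
begin

definition gen_fun :: "nat pmf \<Rightarrow> real \<Rightarrow> real" where
  "gen_fun p s = (\<Sum>k. s ^ k * pmf p k)"

text \<open>
  The generating function lives on the unit interval only; for \<open>s > 1\<close> the series may
  diverge and \<^const>\<open>suminf\<close> would then return an arbitrary value.
\<close>

definition eta :: "nat pmf \<Rightarrow> real" where
  "eta p = Inf {s \<in> {0..1}. gen_fun p s = s}"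

definition zeta :: "nat pmf \<Rightarrow> real" where
  "zeta p = 1 - eta p"

definition pmf_mean :: "nat pmf \<Rightarrow> real" where
  "pmf_mean p = measure_pmf.expectation p real"

text \<open>Meaningful only if \<open>p\<close> has finite nonzero mean, see \<open>pmf_downshifted_size_bias\<close>.\<close>

definition downshifted_size_bias :: "nat pmf \<Rightarrow> nat pmf" where
  "downshifted_size_bias p = embed_pmf (\<lambda>k. real (k + 1) * pmf p (k + 1) / pmf_mean p)"

definition zeta_CM :: "nat pmf \<Rightarrow> real" where
  "zeta_CM p = 1 - gen_fun p (eta (downshifted_size_bias p))"

definition pareto :: "real \<Rightarrow> real \<Rightarrow> real measure" where
  "pareto \<alpha> c = density lborel
     (\<lambda>t. ennreal (if c < t then \<alpha> * c powr \<alpha> * t powr (- \<alpha> - 1) else 0))"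

text \<open>
  Distributions on the nonnegative reals are represented as Borel measures on the reals that
  are concentrated on the nonnegative half line.
\<close>

definition mixed_poisson :: "real measure \<Rightarrow> nat pmf" where
  "mixed_poisson \<mu> = embed_pmf (\<lambda>k. LINT x:{0..}|\<mu>. exp (- x) * x ^ k / fact k)"

definition pareto_mixed_poisson :: "real \<Rightarrow> real \<Rightarrow> nat pmf" where
  "pareto_mixed_poisson lam \<alpha> = mixed_poisson (pareto \<alpha> (lam * (1 - 1 / \<alpha>)))"

text \<open>
  The library's \<^const>\<open>poisson_pmf\<close> is specified for positive rates only. This does not
  affect the set below, since its defining equation fails at rate \<open>0\<close> in any case.
\<close>

definition lambda_cr :: real where
  "lambda_cr = Inf {lam. 0 \<le> lam \<and> lam * zeta (poisson_pmf lam) = 2}"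


subsection \<open>Well-definedness\<close>

lemma gen_fun_1: "gen_fun p 1 = 1"
proof -
  have "pmf p sums measure_pmf.prob p UNIV"
    using measure_pmf.finite_measure_UNION[of "\<lambda>k. {k}" p]
    by (simp add: disjoint_family_on_def measure_pmf_single)
  then show ?thesis
    by (simp add: gen_fun_def sums_iff)
qed

lemma pmf_downshifted_size_bias:
  assumes int: "integrable (measure_pmf p) real" and nz: "pmf_mean p \<noteq> 0"
  shows "pmf (downshifted_size_bias p) k = real (k + 1) * pmf p (k + 1) / pmf_mean p"
proof -
  have m0: "0 < pmf_mean p"
    using nz unfolding pmf_mean_def by (simp add: order_less_le integral_nonneg_AE)
  have "ennreal (pmf_mean p) = (\<integral>\<^sup>+k. ennreal (real k) \<partial>measure_pmf p)"
    unfolding pmf_mean_def using int by (intro nn_integral_eq_integral[symmetric]) auto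
  also have "\<dots> = (\<Sum>k. ennreal (pmf p k) * ennreal (real k))"
    by (simp add: nn_integral_measure_pmf nn_integral_count_space_nat)
  also have "\<dots> = (\<Sum>k. ennreal (pmf p (Suc k)) * ennreal (real (Suc k)))"
    using suminf_offset[of "\<lambda>k. ennreal (pmf p k) * ennreal (real k)" 1] by simp
  finally have *: "ennreal (pmf_mean p)
      = (\<Sum>k. ennreal (pmf p (Suc k)) * ennreal (real (Suc k)))" .
  have "(\<integral>\<^sup>+k. ennreal (real (k + 1) * pmf p (k + 1) / pmf_mean p) \<partial>count_space UNIV)
      = (\<Sum>k. ennreal (1 / pmf_mean p) * (ennreal (pmf p (Suc k)) * ennreal (real (Suc k))))"
    using m0 unfolding nn_integral_count_space_nat
    by (intro suminf_cong) (simp add: ennreal_mult'[symmetric] ac_simps del: of_nat_Suc)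
  also have "\<dots> = ennreal (1 / pmf_mean p) * ennreal (pmf_mean p)"
    by (simp add: ennreal_suminf_cmult *)
  also have "\<dots> = 1"
    using m0 by (simp add: ennreal_mult'[symmetric])
  finally show ?thesis
    unfolding downshifted_size_bias_def using m0 by (intro pmf_embed_pmf) auto
qed

lemma prob_space_pareto:
  assumes "0 < \<alpha>" "0 < c"
  shows "prob_space (pareto \<alpha> c)"
proof -
  have lim: "((\<lambda>t. - (c powr \<alpha> * t powr (- \<alpha>))) \<longlongrightarrow> - (c powr \<alpha> * 0)) at_top"
    using assms by (intro tendsto_intros tendsto_neg_powr filterlim_ident) auto
  have "(\<integral>\<^sup>+t. ennreal (\<alpha> * c powr \<alpha> * t powr (- \<alpha> - 1)) * indicator {c..} t \<partial>lborel)
      = ennreal (- (c powr \<alpha> * 0) - (- (c powr \<alpha> * c powr (- \<alpha>))))"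
    by (rule nn_integral_FTC_atLeast[OF _ _ _ lim])
       (use assms in \<open>auto intro!: derivative_eq_intros\<close>)
  also have "\<dots> = 1"
    using assms by (simp add: powr_minus)
  also have "(\<integral>\<^sup>+t. ennreal (\<alpha> * c powr \<alpha> * t powr (- \<alpha> - 1)) * indicator {c..} t \<partial>lborel)
      = (\<integral>\<^sup>+t. ennreal (if c < t then \<alpha> * c powr \<alpha> * t powr (- \<alpha> - 1) else 0) \<partial>lborel)"
    by (intro nn_integral_cong_AE, rule eventually_mono[OF AE_lborel_singleton[of c]])
       (auto split: split_indicator)
  finally show ?thesis
    by (intro prob_spaceI) (simp add: pareto_def emeasure_density cong: if_cong)
qed

lemma pmf_mixed_poisson:
  assumes "prob_space \<mu>" and [measurable_cong]: "sets \<mu> = sets borel"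
    and nonneg: "AE x in \<mu>. 0 \<le> x"
  shows "pmf (mixed_poisson \<mu>) k = (LINT x:{0..}|\<mu>. exp (- x) * x ^ k / fact k)"
proof -
  interpret prob_space \<mu> by fact
  define g where "g = (\<lambda>(k :: nat) (x :: real). indicator {0..} x * (exp (- x) * x ^ k / fact k))"
  have g0: "0 \<le> g k x" for k x
    by (auto simp: g_def split: split_indicator)
  have gsum: "(\<lambda>k. g k x) sums 1" if "0 \<le> x" for x
    using sums_mult[OF exp_converges[of x], of "exp (- x)"] that
    by (simp add: g_def exp_minus field_simps)
  have g1: "g k x \<le> 1" for k x
    using gsum[of x] sum_le_suminf[of "\<lambda>k. g k x" "{k}"] g0
    by (cases "0 \<le> x") (auto simp: sums_iff g_def)
  have [measurable]: "g k \<in> borel_measurable \<mu>" for k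
    unfolding g_def by measurable
  have int: "integrable \<mu> (g k)" for k
    by (rule integrable_const_bound[of _ 1]) (use g0 g1 in auto)
  have eq: "(LINT x:{0..}|\<mu>. exp (- x) * x ^ k / fact k) = (LINT x|\<mu>. g k x)" for k
    by (simp add: set_lebesgue_integral_def g_def)
  have "(\<integral>\<^sup>+k. ennreal (LINT x|\<mu>. g k x) \<partial>count_space UNIV)
      = (\<Sum>k. \<integral>\<^sup>+x. ennreal (g k x) \<partial>\<mu>)"
    using int g0 by (simp add: nn_integral_count_space_nat nn_integral_eq_integral)
  also have "\<dots> = (\<integral>\<^sup>+x. (\<Sum>k. ennreal (g k x)) \<partial>\<mu>)"
    by (rule nn_integral_suminf[symmetric]) simp
  also have "\<dots> = (\<integral>\<^sup>+x. 1 \<partial>\<mu>)"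
    by (intro nn_integral_cong_AE, rule eventually_mono[OF nonneg])
       (use gsum g0 in \<open>auto simp: sums_iff suminf_ennreal2\<close>)
  also have "\<dots> = 1"
    by (simp add: emeasure_space_1)
  finally show ?thesis
    unfolding mixed_poisson_def eq using g0
    by (intro pmf_embed_pmf) (auto intro!: integral_nonneg_AE)
qed

end

theory Submission
  imports Defs
begin

text \<open>
  With \<open>\<epsilon> = 1 / \<alpha>\<close> and \<open>T\<close> standard exponential, \<open>X\<^sub>\<epsilon> = lam * (1 - \<epsilon>) * exp (\<epsilon> * T)\<close> is the mixing
  variable of \<open>p\<^sub>\<alpha>\<close>, and \<open>\<epsilon> = 0\<close> gives the Poisson case. These variables have mean \<open>lam\<close> and any two
  of them cross exactly once, so they increase with \<open>\<epsilon>\<close> in the convex order. Writing \<open>x = 1 - s\<close>,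
  the generating functions of \<open>p\<^sub>\<alpha>\<close> and of its size biasing are \<open>E (exp (- x X\<^sub>\<epsilon>))\<close> and
  \<open>E (X\<^sub>\<epsilon> exp (- x X\<^sub>\<epsilon>)) / lam\<close>. The integrand of the second is convex only for \<open>x u \<ge> 2\<close>, but
  \<open>X\<^sub>\<epsilon> \<ge> lam * (1 - \<epsilon>)\<close>, so this is no restriction once the relevant \<open>x\<close> satisfies
  \<open>x * lam * (1 - \<epsilon>) \<ge> 2\<close>. Since \<open>lambda_cr = 2 / (1 - exp (- 2))\<close>, for small \<open>\<epsilon>\<close> one has
  \<open>lam * (1 - \<epsilon>) \<ge> lambda_cr\<close>, and then \<open>x = 1 - exp (- 2)\<close> already has the required property and
  lies below the largest root \<open>x\<close> for \<open>p\<^sub>\<alpha>\<close>.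
\<close>

section \<open>Generating functions and extinction probabilities\<close>

lemma summable_pmf_nat: "summable (pmf p)" for p :: "nat pmf"
  using sums_integral_count_space_nat[OF integrable_pmf] by (auto simp: sums_iff)

lemma summable_gen_fun:
  assumes "s \<in> {0..1}"
  shows "summable (\<lambda>k. s ^ k * pmf p k)"
  by (rule summable_comparison_test_ev[OF _ summable_pmf_nat[of p]])
     (use assms in \<open>auto intro!: always_eventually mult_left_le_one_le simp: power_le_one abs_mult\<close>)

lemma gen_fun_mono:
  assumes "0 \<le> s" "s \<le> t" "t \<le> 1"
  shows "gen_fun p s \<le> gen_fun p t"
  unfolding gen_fun_def
  by (intro suminf_le summable_gen_fun mult_right_mono power_mono) (use assms in auto)

lemma gen_fun_nonneg: "0 \<le> s \<Longrightarrow> s \<le> 1 \<Longrightarrow> 0 \<le> gen_fun p s"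
  unfolding gen_fun_def by (intro suminf_nonneg summable_gen_fun) auto

lemma continuous_on_gen_fun: "continuous_on {0..1} (gen_fun p)"
proof (rule uniform_limit_theorem)
  show "uniform_limit {0..1} (\<lambda>n s. \<Sum>k<n. s ^ k * pmf p k) (gen_fun p) sequentially"
    unfolding gen_fun_def
    by (rule Weierstrass_m_test[OF _ summable_pmf_nat[of p]])
       (auto intro!: mult_left_le_one_le simp: power_le_one abs_mult)
qed (auto intro!: always_eventually continuous_intros)

text \<open>By continuity the fixed points form a closed set, and it contains 1, so the infimum is
  attained.\<close>

lemma eta_fixpoint: "eta p \<in> {0..1} \<and> gen_fun p (eta p) = eta p"
proof -
  let ?F = "{s \<in> {0..1}. gen_fun p s = s}"
  have "closed ?F"
    using continuous_closed_preimage_constant[of "{0..1}" "\<lambda>s. gen_fun p s - s" 0]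
    by (simp add: continuous_on_diff continuous_on_gen_fun)
  moreover have "1 \<in> ?F"
    by (simp add: gen_fun_1)
  moreover have "bdd_below ?F"
    by (rule bdd_belowI[of _ 0]) auto
  ultimately have "eta p \<in> ?F"
    unfolding eta_def by (intro closed_contains_Inf) auto
  then show ?thesis by simp
qed

lemma eta_le_fixpoint:
  assumes "0 \<le> s" "s \<le> 1" "gen_fun p s = s"
  shows "eta p \<le> s"
  unfolding eta_def by (rule cInf_lower) (use assms in \<open>auto intro!: bdd_belowI[of _ 0]\<close>)

text \<open>\<open>t - gen_fun p t\<close> is at most 0 at \<open>t = 0\<close> and at least 0 at
  \<open>t = s\<close>, so the intermediate value theorem gives a fixed point in between. Upper
  bounds on extinction probabilities thus reduce to an inequality at a single point.\<close>

lemma eta_le: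
  assumes "0 \<le> s" "s \<le> 1" "gen_fun p s \<le> s"
  shows "eta p \<le> s"
proof -
  have "\<exists>t. 0 \<le> t \<and> t \<le> s \<and> t - gen_fun p t = 0"
    using assms gen_fun_nonneg[of 0 p]
    by (intro IVT' continuous_intros continuous_on_subset[OF continuous_on_gen_fun]) auto
  then obtain t where "0 \<le> t" "t \<le> s" "gen_fun p t = t" by auto
  with eta_le_fixpoint[of t p] assms show ?thesis by simp
qed


section \<open>Mixed Poisson distributions\<close>

locale mixing_law = prob_space M for M :: "real measure" +
  assumes sets_M [measurable_cong]: "sets M = sets borel"
    and nonneg: "AE x in M. 0 \<le> x"
    and integrable_id: "integrable M (\<lambda>x. x)"
    and mean_pos: "0 < (LINT x|M. x)"
begin

lemma integrable_mult_bounded: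
  assumes "integrable M g" "h \<in> borel_measurable borel" "\<And>x. 0 \<le> x \<Longrightarrow> \<bar>h x\<bar> \<le> 1"
  shows "integrable M (\<lambda>x. g x * h x :: real)"
proof (rule Bochner_Integration.integrable_bound[OF assms(1)])
  show "(\<lambda>x. g x * h x) \<in> borel_measurable M"
    using assms(1,2) by measurable
  show "AE x in M. norm (g x * h x) \<le> norm (g x)"
    using nonneg by eventually_elim (use assms(3) in \<open>auto simp: abs_mult intro!: mult_left_le\<close>)
qed

text \<open>Sum and expectation are exchanged by dominated convergence: on the half line the partial
  sums lie between 0 and \<open>g\<close>. The weight \<open>g = 1\<close> yields the generating
  function and \<open>g x = x\<close> that of the size biasing; the latter at \<open>s = 1\<close>
  also yields the mean.\<close>

lemma poisson_mixture_sums: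
  assumes g: "integrable M g" "\<And>x. 0 \<le> x \<Longrightarrow> 0 \<le> g x" and s: "0 \<le> s" "s \<le> 1"
  shows "(\<lambda>k. s ^ k * (LINT x|M. g x * (exp (- x) * x ^ k / fact k))) sums
    (LINT x|M. g x * exp (- ((1 - s) * x)))"
proof -
  let ?f = "\<lambda>k x. g x * (s ^ k * (exp (- x) * x ^ k / fact k))"
  have [measurable]: "g \<in> borel_measurable M"
    using g by auto
  have series: "(\<lambda>k. r ^ k * (exp (- x) * x ^ k / fact k)) sums exp (- ((1 - r) * x))" for r x :: real
    using sums_mult[OF exp_converges[of "r * x"], of "exp (- x)"]
    by (simp add: exp_add[symmetric] algebra_simps power_mult_distrib divide_inverse)
  \<comment> \<open>A single Poisson weight is at most the sum of all of them, which is the series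
    at \<open>r = 1\<close>.\<close>
  have le1: "exp (- x) * x ^ k / fact k \<le> 1" if "0 \<le> x" for k and x :: real
    using series[of 1 x] sum_le_suminf[of "\<lambda>k. exp (- x) * x ^ k / fact k" "{k}"] that
    by (auto simp: sums_iff)
  have int: "integrable M (?f k)" for k
    by (rule integrable_mult_bounded[OF g(1)])
       (use s le1 in \<open>auto simp: abs_mult intro!: mult_le_one power_le_one simp del: times_divide_eq_right\<close>)
  have "(\<lambda>n. LINT x|M. (\<Sum>k<n. ?f k x)) \<longlonglongrightarrow> (LINT x|M. g x * exp (- ((1 - s) * x)))"
  proof (rule integral_dominated_convergence[where w = g])
    show "AE x in M. (\<lambda>n. \<Sum>k<n. ?f k x) \<longlonglongrightarrow> g x * exp (- ((1 - s) * x))"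
      using sums_mult[OF series] by (auto simp: sums_def)
    show "AE x in M. norm (\<Sum>k<n. ?f k x) \<le> g x" for n
      using nonneg
    proof eventually_elim
      case (elim x)
      have gx: "0 \<le> g x"
        using elim by (rule g(2))
      have "0 \<le> (\<Sum>k<n. ?f k x)"
        using elim s gx by (intro sum_nonneg mult_nonneg_nonneg divide_nonneg_nonneg) auto
      then have "norm (\<Sum>k<n. ?f k x) = (\<Sum>k<n. ?f k x)"
        by (simp only: real_norm_def abs_of_nonneg)
      also have "\<dots> = g x * (\<Sum>k<n. s ^ k * (exp (- x) * x ^ k / fact k))"
        by (simp add: sum_distrib_left)
      also have "\<dots> \<le> g x * exp (- ((1 - s) * x))"
        unfolding sums_unique[OF series[of s x]] using sums_summable[OF series[of s x]] elim s gx
        by (intro mult_left_mono sum_le_suminf) auto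
      also have "\<dots> \<le> g x"
        using elim s gx by (intro mult_left_le) auto
      finally show ?case .
    qed
  qed (use g in auto)
  also have "(\<lambda>n. LINT x|M. (\<Sum>k<n. ?f k x)) =
      (\<lambda>n. \<Sum>k<n. s ^ k * (LINT x|M. g x * (exp (- x) * x ^ k / fact k)))"
  proof
    fix n
    have "(LINT x|M. (\<Sum>k<n. ?f k x)) = (\<Sum>k<n. LINT x|M. ?f k x)"
      by (rule Bochner_Integration.integral_sum) (rule int)
    also have "\<dots> = (\<Sum>k<n. LINT x|M. s ^ k * (g x * (exp (- x) * x ^ k / fact k)))"
      by (simp add: ac_simps)
    finally show "(LINT x|M. (\<Sum>k<n. ?f k x)) =
        (\<Sum>k<n. s ^ k * (LINT x|M. g x * (exp (- x) * x ^ k / fact k)))"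
      by simp
  qed
  finally show ?thesis
    by (simp add: sums_def)
qed

lemma pmf_mixed_poisson_integral:
  "pmf (mixed_poisson M) k = (LINT x|M. exp (- x) * x ^ k / fact k)"
proof -
  have "pmf (mixed_poisson M) k = (LINT x:{0..}|M. exp (- x) * x ^ k / fact k)"
    by (rule pmf_mixed_poisson) (simp_all add: prob_space_axioms sets_M nonneg)
  also have "\<dots> = (LINT x|M. exp (- x) * x ^ k / fact k)"
    unfolding set_lebesgue_integral_def
    by (rule integral_cong_AE) (use nonneg in \<open>auto\<close>)
  finally show ?thesis .
qed

lemma gen_fun_mixed_poisson:
  assumes "0 \<le> s" "s \<le> 1"
  shows "gen_fun (mixed_poisson M) s = (LINT x|M. exp (- ((1 - s) * x)))"
  using poisson_mixture_sums[of "\<lambda>_. 1" s] assms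
  by (simp add: gen_fun_def pmf_mixed_poisson_integral sums_iff)

text \<open>The factor \<open>k + 1\<close> cancels against the factorial and leaves one factor
  \<open>x\<close>, so size biasing the mixture and shifting it down amounts to weighting the mixing
  law by \<open>x\<close>.\<close>

lemma Suc_times_pmf_mixed_poisson:
  "real (Suc k) * pmf (mixed_poisson M) (Suc k) = (LINT x|M. x * (exp (- x) * x ^ k / fact k))"
proof -
  have "real (Suc k) * pmf (mixed_poisson M) (Suc k)
      = (LINT x|M. real (Suc k) * (exp (- x) * x ^ Suc k / fact (Suc k)))"
    unfolding pmf_mixed_poisson_integral by (rule Bochner_Integration.integral_mult_right_zero[symmetric])
  also have "\<dots> = (LINT x|M. x * (exp (- x) * x ^ k / fact k))"
    by (intro Bochner_Integration.integral_cong refl) (simp add: divide_simps del: of_nat_Suc)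
  finally show ?thesis .
qed

lemma mean_mixed_poisson:
  "integrable (measure_pmf (mixed_poisson M)) real \<and> pmf_mean (mixed_poisson M) = (LINT x|M. x)"
proof -
  let ?p = "mixed_poisson M"
  have "(\<lambda>k. real (Suc k) * pmf ?p (Suc k)) sums (LINT x|M. x)"
    using poisson_mixture_sums[of "\<lambda>x. x" 1] integrable_id
    by (simp add: Suc_times_pmf_mixed_poisson del: of_nat_Suc)
  \<comment> \<open>Undoing the index shift adds only the term at \<open>k = 0\<close>, which
    vanishes.\<close>
  then have "(\<lambda>k. pmf ?p k * real k) sums (LINT x|M. x)"
    using sums_Suc_iff[of "\<lambda>k. pmf ?p k * real k"] by (simp add: mult.commute del: of_nat_Suc)
  then have "(\<Sum>k. ennreal (pmf ?p k * real k)) = ennreal (LINT x|M. x)"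
    by (auto simp: sums_iff suminf_ennreal2)
  then have "(\<integral>\<^sup>+k. ennreal (real k) \<partial>measure_pmf ?p) = ennreal (LINT x|M. x)"
    by (simp add: nn_integral_measure_pmf nn_integral_count_space_nat ennreal_mult'[symmetric])
  then have "has_bochner_integral (measure_pmf ?p) real (LINT x|M. x)"
    using mean_pos by (intro has_bochner_integral_nn_integral) auto
  then show ?thesis
    by (simp add: has_bochner_integral_iff pmf_mean_def)
qed

lemma gen_fun_downshifted_size_bias:
  assumes "0 \<le> s" "s \<le> 1"
  shows "gen_fun (downshifted_size_bias (mixed_poisson M)) s =
    (LINT x|M. x * exp (- ((1 - s) * x))) / (LINT x|M. x)"
proof -
  have "pmf (downshifted_size_bias (mixed_poisson M)) k =
      (LINT x|M. x * (exp (- x) * x ^ k / fact k)) / (LINT x|M. x)" for k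
    using pmf_downshifted_size_bias[of "mixed_poisson M" k] mean_mixed_poisson mean_pos
      Suc_times_pmf_mixed_poisson[of k] by simp
  then show ?thesis
    using sums_divide[OF poisson_mixture_sums[of "\<lambda>x. x" s], of "LINT x|M. x"] assms integrable_id
    by (simp add: gen_fun_def sums_iff)
qed

end


section \<open>Pareto laws as transforms of the exponential law\<close>

lemma measure_pareto_atMost:
  assumes "0 < \<alpha>" "0 < c"
  shows "measure (pareto \<alpha> c) {..x} = (if c \<le> x then 1 - (c / x) powr \<alpha> else 0)"
proof -
  let ?f = "\<lambda>t. \<alpha> * c powr \<alpha> * t powr (- \<alpha> - 1)"
  \<comment> \<open>The density is cut off at \<open>c < t\<close>; passing to the closed interval
    needed for the fundamental theorem changes the integrand only on the null set
    \<open>{c}\<close>.\<close>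
  have "emeasure (pareto \<alpha> c) {..x} = (\<integral>\<^sup>+t. ennreal (?f t) * indicator {c..x} t \<partial>lborel)"
    unfolding pareto_def
    by (subst emeasure_density, (simp cong: if_cong)+, intro nn_integral_cong_AE,
        rule eventually_mono[OF AE_lborel_singleton[of c]])
       (auto split: split_indicator)
  also have "\<dots> = ennreal (if c \<le> x then 1 - (c / x) powr \<alpha> else 0)"
  proof (cases "c \<le> x")
    case True
    have "(\<integral>\<^sup>+t. ennreal (?f t) * indicator {c..x} t \<partial>lborel) =
        ennreal (- (c powr \<alpha> * x powr (- \<alpha>)) - (- (c powr \<alpha> * c powr (- \<alpha>))))"
      by (rule nn_integral_FTC_Icc)
         (use assms True in \<open>auto intro!: derivative_eq_intros\<close>)
    also have "\<dots> = ennreal (1 - (c / x) powr \<alpha>)"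
      using assms True by (simp add: powr_minus_divide powr_divide)
    finally show ?thesis using True by simp
  qed simp
  finally show ?thesis
    using assms by (auto simp: measure_def powr_le1)
qed

text \<open>Inverse transform sampling, checked on distribution functions. It realises the Pareto
  laws of all shapes as functions of one exponential variable, so that they can be compared
  pointwise.\<close>

lemma pareto_eq_distr_exponential:
  assumes "0 < \<alpha>" "0 < c"
  shows "pareto \<alpha> c =
    distr (density lborel (exponential_density 1)) borel (\<lambda>t. c * exp (t / \<alpha>))"
    (is "_ = distr ?E _ ?X")
proof (rule cdf_unique)
  interpret E: prob_space ?E
    by (rule prob_space_exponential_density) simp
  interpret P: prob_space "pareto \<alpha> c"
    by (rule prob_space_pareto) fact+
  show "real_distribution (pareto \<alpha> c)"
    by unfold_locales (simp_all add: pareto_def)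
  show "real_distribution (distr ?E borel ?X)"
    by (rule E.real_distribution_distr) simp
  show "cdf (pareto \<alpha> c) = cdf (distr ?E borel ?X)"
  proof
    fix x
    have "cdf (distr ?E borel ?X) x = measure ?E {t. ?X t \<le> x}"
      by (simp add: cdf_def measure_distr vimage_def)
    also have "\<dots> = (if c \<le> x then 1 - (c / x) powr \<alpha> else 0)"
    proof (cases "0 < x")
      case True
      have "?X t \<le> x \<longleftrightarrow> t \<le> \<alpha> * ln (x / c)" for t
      proof -
        have "?X t \<le> x \<longleftrightarrow> exp (t / \<alpha>) \<le> x / c"
          using assms by (simp add: pos_le_divide_eq mult.commute)
        also have "\<dots> \<longleftrightarrow> t / \<alpha> \<le> ln (x / c)"
          using assms True by (simp add: ln_ge_iff)
        also have "\<dots> \<longleftrightarrow> t \<le> \<alpha> * ln (x / c)"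
          using assms by (simp add: pos_divide_le_eq mult.commute)
        finally show ?thesis .
      qed
      then have "{t. ?X t \<le> x} = {..\<alpha> * ln (x / c)}"
        by auto
      moreover have "0 \<le> \<alpha> * ln (x / c) \<longleftrightarrow> c \<le> x"
        using assms True by (simp add: zero_le_mult_iff)
      moreover have "exp (- (\<alpha> * ln (x / c))) = (c / x) powr \<alpha>"
        using assms True by (simp add: powr_def ln_div algebra_simps)
      moreover have "c \<le> x \<Longrightarrow> (c / x) powr \<alpha> \<le> 1"
        using assms by (intro powr_le1) auto
      ultimately show ?thesis
        by (auto simp: measure_def emeasure_erlang_density erlang_CDF_0)
    next
      case False
      have "0 < ?X t" for t
        using assms by simp
      then have "{t. ?X t \<le> x} = {}"
        using False by (auto simp: not_le intro: order_le_less_trans[of x 0])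
      then show ?thesis
        using False assms by simp
    qed
    finally show "cdf (pareto \<alpha> c) x = cdf (distr ?E borel ?X) x"
      using assms by (simp add: cdf_def measure_pareto_atMost)
  qed
qed

text \<open>
  For \<open>\<epsilon> > 0\<close> this is the Pareto law of shape \<open>1 / \<epsilon>\<close> and mean \<open>lam\<close>; for \<open>\<epsilon> = 0\<close> it is the
  point mass at \<open>lam\<close>, whose mixed Poisson distribution is the Poisson distribution itself.
\<close>

definition pareto_law :: "real \<Rightarrow> real \<Rightarrow> real measure" where
  "pareto_law lam \<epsilon> = distr (density lborel (exponential_density 1)) borel
     (\<lambda>t. lam * (1 - \<epsilon>) * exp (\<epsilon> * t))"

lemma AE_exponential_nonneg: "AE t in density lborel (exponential_density 1). 0 \<le> t"
  by (subst AE_density) (auto simp: exponential_density_def)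

lemma AE_pareto_law_ge:
  assumes "0 < lam" "0 \<le> \<epsilon>" "\<epsilon> < 1"
  shows "AE x in pareto_law lam \<epsilon>. lam * (1 - \<epsilon>) \<le> x"
proof -
  have "AE t in density lborel (exponential_density 1). lam * (1 - \<epsilon>) \<le> lam * (1 - \<epsilon>) * exp (\<epsilon> * t)"
    using AE_exponential_nonneg
  proof eventually_elim
    case (elim t)
    then show ?case
      using mult_left_mono[of 1 "exp (\<epsilon> * t)" "lam * (1 - \<epsilon>)"] assms by simp
  qed
  then show ?thesis
    unfolding pareto_law_def by (subst AE_distr_iff) auto
qed

lemma has_bochner_integral_pareto_law_id:
  assumes "0 < lam" "0 \<le> \<epsilon>" "\<epsilon> < 1"
  shows "has_bochner_integral (pareto_law lam \<epsilon>) (\<lambda>x. x) lam"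
proof -
  \<comment> \<open>The factor \<open>(1 - \<epsilon>) * exp (\<epsilon> * t)\<close> turns the
    exponential density of rate 1 into that of rate \<open>1 - \<epsilon>\<close>, whose total mass
    is 1.\<close>
  interpret prob_space "density lborel (exponential_density (1 - \<epsilon>))"
    by (rule prob_space_exponential_density) (use assms in auto)
  have "(\<integral>\<^sup>+x. ennreal x \<partial>pareto_law lam \<epsilon>) =
      (\<integral>\<^sup>+t. ennreal (exponential_density 1 t) * ennreal (lam * (1 - \<epsilon>) * exp (\<epsilon> * t)) \<partial>lborel)"
    unfolding pareto_law_def by (simp add: nn_integral_distr nn_integral_density)
  also have "\<dots> = (\<integral>\<^sup>+t. ennreal lam * ennreal (exponential_density (1 - \<epsilon>) t) \<partial>lborel)"
    using assms
    by (intro nn_integral_cong)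
       (auto simp: exponential_density_def ennreal_mult'[symmetric] exp_add[symmetric] algebra_simps)
  also have "\<dots> = ennreal lam * emeasure (density lborel (exponential_density (1 - \<epsilon>))) UNIV"
    by (simp add: nn_integral_cmult emeasure_density)
  also have "\<dots> = ennreal lam"
    using emeasure_space_1 by simp
  finally show ?thesis
    using assms AE_pareto_law_ge[OF assms]
    by (intro has_bochner_integral_nn_integral) (auto simp: pareto_law_def elim!: eventually_mono
        intro: order_trans[rotated])
qed

lemma mixing_law_pareto_law:
  assumes "0 < lam" "0 \<le> \<epsilon>" "\<epsilon> < 1"
  shows "mixing_law (pareto_law lam \<epsilon>)"
proof -
  interpret E: prob_space "density lborel (exponential_density 1)"
    by (rule prob_space_exponential_density) simp
  interpret prob_space "pareto_law lam \<epsilon>"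
    unfolding pareto_law_def by (rule E.prob_space_distr) simp
  show ?thesis
  proof
    show "AE x in pareto_law lam \<epsilon>. 0 \<le> x"
      using assms AE_pareto_law_ge[OF assms]
      by (auto elim!: eventually_mono intro: order_trans[rotated])
    show "integrable (pareto_law lam \<epsilon>) (\<lambda>x. x)" "0 < (LINT x|pareto_law lam \<epsilon>. x)"
      using has_bochner_integral_pareto_law_id[OF assms] assms by (auto simp: has_bochner_integral_iff)
  qed (simp add: pareto_law_def)
qed

lemma pareto_mixed_poisson_eq:
  assumes "0 < lam" "1 < \<alpha>"
  shows "pareto_mixed_poisson lam \<alpha> = mixed_poisson (pareto_law lam (1 / \<alpha>))"
  using assms unfolding pareto_mixed_poisson_def pareto_law_def
  by (subst pareto_eq_distr_exponential) auto

lemma poisson_eq_mixed_poisson: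
  assumes "0 < lam"
  shows "poisson_pmf lam = mixed_poisson (pareto_law lam 0)"
proof (rule pmf_eqI)
  fix k
  interpret mixing_law "pareto_law lam 0"
    by (rule mixing_law_pareto_law) (use assms in auto)
  interpret E: prob_space "density lborel (exponential_density 1)"
    by (rule prob_space_exponential_density) simp
  have "pareto_law lam 0 = return borel lam"
    by (simp add: pareto_law_def)
  then show "pmf (poisson_pmf lam) k = pmf (mixed_poisson (pareto_law lam 0)) k"
    unfolding pmf_mixed_poisson_integral using assms by (simp add: integral_return)
qed


section \<open>Monotonicity in the convex order\<close>

text \<open>The chord between \<open>a\<close> and \<open>b\<close> has slope \<open>f' z\<close>
  for some \<open>z\<close> between them, on the same side of \<open>t\<close> as both; replacing it
  by \<open>f' t\<close> only lowers the left side. A slope that does not depend on \<open>a\<close>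
  and \<open>b\<close> keeps the correction linear under the integral.\<close>

lemma tangent_slope_single_crossing:
  fixes f f' :: "real \<Rightarrow> real"
  assumes der: "\<And>u. c \<le> u \<Longrightarrow> (f has_real_derivative f' u) (at u)"
    and mono: "mono_on {c..} f'"
    and ge: "c \<le> a" "c \<le> b" "c \<le> t"
    and cross: "(a \<le> b \<and> b \<le> t) \<or> (t \<le> b \<and> b \<le> a)"
  shows "f b + f' t * (a - b) \<le> f a"
proof -
  consider "a = b" | "a < b" "b \<le> t" | "t \<le> b" "b < a"
    using cross by linarith
  then show ?thesis
  proof cases
    case 2
    then obtain z where "a < z" "z < b" "f b - f a = (b - a) * f' z"
      using MVT2[of a b f f'] der ge by force
    moreover from this have "f' z \<le> f' t"
      using 2 ge by (intro mono_onD[OF mono]) auto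
    ultimately show ?thesis
      using 2 mult_left_mono[of "f' z" "f' t" "b - a"] by (simp add: algebra_simps)
  next
    case 3
    then obtain z where "b < z" "z < a" "f a - f b = (a - b) * f' z"
      using MVT2[of b a f f'] der ge by force
    moreover from this have "f' t \<le> f' z"
      using 3 ge by (intro mono_onD[OF mono]) auto
    ultimately show ?thesis
      using 3 mult_left_mono[of "f' t" "f' z" "a - b"] by (simp add: algebra_simps)
  qed simp
qed

text \<open>
  Comparing with the slope \<open>f'\<close> at the crossing value, the linear terms cancel because the means
  agree.
\<close>

lemma pareto_law_convex_order:
  fixes f f' :: "real \<Rightarrow> real"
  assumes lam: "0 < lam" and eps: "0 \<le> \<delta>" "\<delta> \<le> \<epsilon>" "\<epsilon> < 1"
    and der: "\<And>u. lam * (1 - \<epsilon>) \<le> u \<Longrightarrow> (f has_real_derivative f' u) (at u)"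
    and mono: "mono_on {lam * (1 - \<epsilon>)..} f'"
    and int: "integrable (pareto_law lam \<epsilon>) f" "integrable (pareto_law lam \<delta>) f"
  shows "(LINT x|pareto_law lam \<delta>. f x) \<le> (LINT x|pareto_law lam \<epsilon>. f x)"
proof (cases "\<delta> = \<epsilon>")
  case False
  then have less: "\<delta> < \<epsilon>" using eps by simp
  let ?E = "density lborel (exponential_density 1)"
  define X where "X = (\<lambda>e t. lam * (1 - e) * exp (e * t))"
  have X_meas [measurable]: "X e \<in> borel_measurable borel" for e
    unfolding X_def by measurable
  have law: "pareto_law lam e = distr ?E borel (X e)" for e
    by (simp add: pareto_law_def X_def)
  have f_meas [measurable]: "f \<in> borel_measurable borel"
    using int(1) by (auto simp: law dest: borel_measurable_integrable)
  have id: "integrable ?E (X e) \<and> (LINT t|?E. X e t) = lam" if "0 \<le> e" "e < 1" for e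
    using has_bochner_integral_pareto_law_id[OF lam that]
    by (auto simp: law has_bochner_integral_iff integrable_distr_eq integral_distr)
  have f_int: "integrable ?E (\<lambda>t. f (X \<delta> t))" "integrable ?E (\<lambda>t. f (X \<epsilon> t))"
    using int by (simp_all add: law integrable_distr_eq)
  \<comment> \<open>The crossing time, where \<open>X \<epsilon> \<tau> = X \<delta> \<tau>\<close>.
    It is unique because \<open>ln (X \<epsilon> t) - ln (X \<delta> t)\<close> is
    \<open>(\<epsilon> - \<delta>) * (t - \<tau>)\<close>; the division requires
    \<open>\<delta> \<noteq> \<epsilon>\<close>.\<close>
  define \<tau> where "\<tau> = ln ((1 - \<delta>) / (1 - \<epsilon>)) / (\<epsilon> - \<delta>)"
  have \<tau>: "0 \<le> \<tau>" "ln (1 - \<delta>) + \<delta> * \<tau> = ln (1 - \<epsilon>) + \<epsilon> * \<tau>"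
    using less eps by (auto simp: \<tau>_def ln_div field_simps)
  have X_exp: "X e t = lam * exp (ln (1 - e) + e * t)" if "e < 1" for e t
    using that by (simp add: X_def exp_add)
  have X_ge: "lam * (1 - \<epsilon>) \<le> X e t" if "0 \<le> e" "e \<le> \<epsilon>" "0 \<le> t" for e t
  proof -
    have "lam * (1 - \<epsilon>) \<le> lam * (1 - e)" using lam that by simp
    also have "\<dots> \<le> X e t" 
      using mult_left_mono[of 1 "exp (e * t)" "lam * (1 - e)"] lam that eps by (simp add: X_def)
    finally show ?thesis .
  qed
  have "AE t in ?E. f (X \<delta> t) + f' (X \<delta> \<tau>) * (X \<epsilon> t - X \<delta> t) \<le> f (X \<epsilon> t)"
    using AE_exponential_nonneg
  proof eventually_elim
    case (elim t)
    \<comment> \<open>Before \<open>\<tau>\<close> the variable \<open>X \<epsilon>\<close> is the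
      smaller one and \<open>X \<delta>\<close> is below its crossing value; after
      \<open>\<tau>\<close> both relations are reversed.\<close>
    have "(\<epsilon> - \<delta>) * t \<le> (\<epsilon> - \<delta>) * \<tau> \<and> \<delta> * t \<le> \<delta> * \<tau>
        \<or> (\<epsilon> - \<delta>) * \<tau> \<le> (\<epsilon> - \<delta>) * t \<and> \<delta> * \<tau> \<le> \<delta> * t"
      using less eps by (cases "t \<le> \<tau>") (auto intro!: mult_left_mono)
    then have "(X \<epsilon> t \<le> X \<delta> t \<and> X \<delta> t \<le> X \<delta> \<tau>) \<or> (X \<delta> \<tau> \<le> X \<delta> t \<and> X \<delta> t \<le> X \<epsilon> t)"
      using \<tau>(2) lam less eps by (auto simp: X_exp algebra_simps)
    then show ?case
      using elim \<tau>(1) less eps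
      by (intro tangent_slope_single_crossing[OF der mono] X_ge) auto
  qed
  then have "(LINT t|?E. f (X \<delta> t) + f' (X \<delta> \<tau>) * (X \<epsilon> t - X \<delta> t)) \<le> (LINT t|?E. f (X \<epsilon> t))"
    using f_int id[of \<delta>] id[of \<epsilon>] eps less by (intro integral_mono_AE) auto
  then have "(LINT t|?E. f (X \<delta> t)) \<le> (LINT t|?E. f (X \<epsilon> t))"
    using f_int id[of \<delta>] id[of \<epsilon>] eps less by simp
  then show ?thesis
    by (simp add: law integral_distr)
qed simp

lemma pareto_law_exp_mono:
  assumes "0 < lam" "0 \<le> \<delta>" "\<delta> \<le> \<epsilon>" "\<epsilon> < 1" "0 \<le> x"
  shows "(LINT u|pareto_law lam \<delta>. exp (- (x * u))) \<le> (LINT u|pareto_law lam \<epsilon>. exp (- (x * u)))"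
proof -
  have int: "integrable (pareto_law lam e) (\<lambda>u. exp (- (x * u)))" if "0 \<le> e" "e \<le> \<epsilon>" for e
  proof -
    interpret mixing_law "pareto_law lam e"
      by (rule mixing_law_pareto_law) (use assms that in auto)
    show ?thesis
      using integrable_mult_bounded[of "\<lambda>_. 1" "\<lambda>u. exp (- (x * u))"] assms by simp
  qed
  show ?thesis
    by (rule pareto_law_convex_order[where f' = "\<lambda>u. - x * exp (- (x * u))"])
       (use assms int in \<open>auto intro!: derivative_eq_intros mono_onI mult_left_mono\<close>)
qed

lemma pareto_law_id_exp_mono:
  assumes "0 < lam" "0 \<le> \<delta>" "\<delta> \<le> \<epsilon>" "\<epsilon> < 1" "0 \<le> x" and large: "2 \<le> x * (lam * (1 - \<epsilon>))"
  shows "(LINT u|pareto_law lam \<delta>. u * exp (- (x * u))) \<le> (LINT u|pareto_law lam \<epsilon>. u * exp (- (x * u)))"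
proof (rule pareto_law_convex_order[where f' = "\<lambda>u. (1 - x * u) * exp (- (x * u))"])
  have "integrable (pareto_law lam e) (\<lambda>u. u * exp (- (x * u)))" if "0 \<le> e" "e \<le> \<epsilon>" for e
  proof -
    interpret mixing_law "pareto_law lam e"
      by (rule mixing_law_pareto_law) (use assms that in auto)
    show ?thesis
      using integrable_mult_bounded[OF integrable_id, of "\<lambda>u. exp (- (x * u))"] assms by simp
  qed
  then show "integrable (pareto_law lam \<epsilon>) (\<lambda>u. u * exp (- (x * u)))"
    "integrable (pareto_law lam \<delta>) (\<lambda>u. u * exp (- (x * u)))"
    using assms by auto
  show "mono_on {lam * (1 - \<epsilon>)..} (\<lambda>u. (1 - x * u) * exp (- (x * u)))"
  proof (rule mono_onI)
    fix u v assume uv: "u \<in> {lam * (1 - \<epsilon>)..}" "u \<le> v"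
    show "(1 - x * u) * exp (- (x * u)) \<le> (1 - x * v) * exp (- (x * v))"
    proof (rule DERIV_nonneg_imp_nondecreasing[OF uv(2)], intro exI conjI)
      \<comment> \<open>The derivative below is the second derivative of
        \<open>u * exp (- (x * u))\<close>; \<open>large\<close> makes it nonnegative on the whole
        half line.\<close>
      fix w assume "u \<le> w"
      then have "x * (lam * (1 - \<epsilon>)) \<le> x * w"
        using uv assms by (intro mult_left_mono) auto
      then show "0 \<le> x * (x * w - 2) * exp (- (x * w))"
        using large assms by simp
      show "((\<lambda>u. (1 - x * u) * exp (- (x * u))) has_real_derivative
          x * (x * w - 2) * exp (- (x * w))) (at w)"
        by (auto intro!: derivative_eq_intros simp: algebra_simps)
    qed
  qed
qed (use assms in \<open>auto intro!: derivative_eq_intros simp: algebra_simps\<close>)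


section \<open>The critical parameter\<close>

lemma gen_fun_poisson:
  assumes "0 < lam"
  shows "gen_fun (poisson_pmf lam) s = exp (- (lam * (1 - s)))"
proof -
  have "(\<lambda>k. s ^ k * pmf (poisson_pmf lam) k) sums exp (- (lam * (1 - s)))"
    using sums_mult[OF exp_converges[of "s * lam"], of "exp (- lam)"] assms
    by (simp add: exp_add[symmetric] algebra_simps power_mult_distrib divide_inverse)
  then show ?thesis
    by (simp add: gen_fun_def sums_iff)
qed

text \<open>If \<open>lam * zeta = 2\<close>, the fixed point equation for the Poisson law reads
  \<open>eta = exp (- lam * zeta) = exp (- 2)\<close>, which determines \<open>lam\<close>.
  Conversely, at this rate \<open>exp (- 2)\<close> is a fixed point, and it has to be shown to be
  the smallest.\<close>

lemma lambda_cr_eq: "lambda_cr = 2 / (1 - exp (- 2))"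
proof -
  define L :: real where "L = 2 / (1 - exp (- 2))"
  have L: "0 < L" "L * (1 - exp (- 2)) = 2"
    by (auto simp: L_def simp del: right_diff_distrib_numeral left_diff_distrib_numeral)
  have unique: "lam = L" if "0 \<le> lam" "lam * zeta (poisson_pmf lam) = 2" for lam
  proof -
    \<comment> \<open>At rate 0 the equation reads \<open>0 = 2\<close>, whatever value
      \<open>zeta\<close> takes there.\<close>
    have pos: "0 < lam"
      using that by (cases "lam = 0") auto
    have "eta (poisson_pmf lam) = exp (- 2)"
      using eta_fixpoint[of "poisson_pmf lam"] that pos by (simp add: gen_fun_poisson zeta_def)
    then show ?thesis
      using that by (simp add: L_def zeta_def field_simps)
  qed
  have eta: "eta (poisson_pmf L) = exp (- 2)"
  proof (rule ccontr)
    \<comment> \<open>A smaller fixed point would give \<open>?h\<close> three zeros, the others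
      being \<open>exp (- 2)\<close> and 1. By the mean value theorem \<open>?h'\<close> would then
      vanish at two points, but it is strictly increasing.\<close>
    let ?h = "\<lambda>s. exp (- (L * (1 - s))) - s" and ?h' = "\<lambda>s. L * exp (- (L * (1 - s))) - 1"
    define s where "s = eta (poisson_pmf L)"
    assume "eta (poisson_pmf L) \<noteq> exp (- 2)"
    moreover have "eta (poisson_pmf L) \<le> exp (- 2)"
      using L by (intro eta_le_fixpoint) (auto simp: gen_fun_poisson)
    ultimately have s: "s < exp (- 2)" "?h s = 0"
      using eta_fixpoint[of "poisson_pmf L"] L by (auto simp: s_def gen_fun_poisson)
    have der: "DERIV ?h z :> ?h' z" for z
      by (auto intro!: derivative_eq_intros)
    obtain z where z: "z < exp (- 2)" "?h (exp (- 2)) - ?h s = (exp (- 2) - s) * ?h' z"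
      using MVT2[OF s(1) der] by auto
    obtain w where w: "exp (- 2) < w" "?h 1 - ?h (exp (- 2)) = (1 - exp (- 2)) * ?h' w"
      using MVT2[of "exp (- 2)" 1 ?h ?h'] der by auto
    have "?h' z = 0" "?h' w = 0"
      using z w s L by auto
    then have "L * exp (- (L * (1 - z))) = L * exp (- (L * (1 - w)))"
      by linarith
    then show False
      using z w L by auto
  qed
  have "{lam. 0 \<le> lam \<and> lam * zeta (poisson_pmf lam) = 2} = {L}"
    using unique eta L by (auto simp: zeta_def)
  then show ?thesis
    by (simp add: lambda_cr_def L_def)
qed


section \<open>Comparison of the extinction probabilities\<close>

text \<open>At \<open>s = exp (- 2)\<close> the support bound gives
  \<open>(1 - s) * u \<ge> 2\<close>, so the exponential factor is at most \<open>s\<close> and the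
  generating function of the size biasing is at most \<open>s\<close> there.\<close>

lemma eta_pareto_law_le:
  assumes "0 < lam" "0 \<le> \<epsilon>" "\<epsilon> < 1" "2 \<le> (1 - exp (- 2)) * (lam * (1 - \<epsilon>))"
  shows "eta (downshifted_size_bias (mixed_poisson (pareto_law lam \<epsilon>))) \<le> exp (- 2)"
proof (rule eta_le)
  interpret mixing_law "pareto_law lam \<epsilon>"
    by (rule mixing_law_pareto_law) (use assms in auto)
  have mean: "(LINT u|pareto_law lam \<epsilon>. u) = lam"
    using has_bochner_integral_pareto_law_id[of lam \<epsilon>] assms by (simp add: has_bochner_integral_iff)
  have "(LINT u|pareto_law lam \<epsilon>. u * exp (- ((1 - exp (- 2)) * u))) \<le>
      (LINT u|pareto_law lam \<epsilon>. u * exp (- 2))"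
  proof (rule integral_mono_AE)
    show "integrable (pareto_law lam \<epsilon>) (\<lambda>u. u * exp (- ((1 - exp (- 2)) * u)))"
      by (rule integrable_mult_bounded[OF integrable_id]) auto
    show "AE u in pareto_law lam \<epsilon>. u * exp (- ((1 - exp (- 2)) * u)) \<le> u * exp (- 2)"
      using nonneg AE_pareto_law_ge[OF assms(1-3)]
    proof eventually_elim
      case (elim u)
      have "(1 - exp (- 2)) * (lam * (1 - \<epsilon>)) \<le> (1 - exp (- 2)) * u"
        using elim by (intro mult_left_mono) auto
      from order_trans[OF assms(4) this] show ?case
        using elim by (intro mult_left_mono) auto
    qed
  qed (use integrable_id in auto)
  then show "gen_fun (downshifted_size_bias (mixed_poisson (pareto_law lam \<epsilon>))) (exp (- 2)) \<le> exp (- 2)"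
    using assms by (simp add: gen_fun_downshifted_size_bias mean field_simps)
qed auto

lemma zeta_CM_pareto_law_antimono:
  assumes "0 < lam" "0 \<le> \<delta>" "\<delta> \<le> \<epsilon>" "\<epsilon> < 1" and large: "2 \<le> (1 - exp (- 2)) * (lam * (1 - \<epsilon>))"
  shows "zeta_CM (mixed_poisson (pareto_law lam \<epsilon>)) \<le> zeta_CM (mixed_poisson (pareto_law lam \<delta>))"
proof -
  interpret E: mixing_law "pareto_law lam \<epsilon>"
    by (rule mixing_law_pareto_law) (use assms in auto)
  interpret D: mixing_law "pareto_law lam \<delta>"
    by (rule mixing_law_pareto_law) (use assms in auto)
  have mean: "(LINT u|pareto_law lam \<epsilon>. u) = lam" "(LINT u|pareto_law lam \<delta>. u) = lam"
    using has_bochner_integral_pareto_law_id[of lam] assms by (simp_all add: has_bochner_integral_iff)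
  let ?e = "eta (downshifted_size_bias (mixed_poisson (pareto_law lam \<epsilon>)))"
  let ?d = "eta (downshifted_size_bias (mixed_poisson (pareto_law lam \<delta>)))"
  have e: "0 \<le> ?e" "?e \<le> 1"
    and fix_e: "gen_fun (downshifted_size_bias (mixed_poisson (pareto_law lam \<epsilon>))) ?e = ?e"
    using eta_fixpoint[of "downshifted_size_bias (mixed_poisson (pareto_law lam \<epsilon>))"] by auto
  have d: "0 \<le> ?d"
    using eta_fixpoint[of "downshifted_size_bias (mixed_poisson (pareto_law lam \<delta>))"] by auto
  \<comment> \<open>Since \<open>?e \<le> exp (- 2)\<close>, the convexity condition passes from
    \<open>1 - exp (- 2)\<close> to \<open>1 - ?e\<close>. Comparing at the fixed point for the
    larger parameter then gives \<open>?d \<le> ?e\<close>.\<close>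
  have "(1 - exp (- 2)) * (lam * (1 - \<epsilon>)) \<le> (1 - ?e) * (lam * (1 - \<epsilon>))"
    using assms eta_pareto_law_le[of lam \<epsilon>] by (intro mult_right_mono) auto
  from order_trans[OF large this]
  have "(LINT u|pareto_law lam \<delta>. u * exp (- ((1 - ?e) * u))) \<le>
      (LINT u|pareto_law lam \<epsilon>. u * exp (- ((1 - ?e) * u)))"
    using assms e by (intro pareto_law_id_exp_mono) auto
  then have "gen_fun (downshifted_size_bias (mixed_poisson (pareto_law lam \<delta>))) ?e \<le>
      gen_fun (downshifted_size_bias (mixed_poisson (pareto_law lam \<epsilon>))) ?e"
    unfolding E.gen_fun_downshifted_size_bias[OF e] D.gen_fun_downshifted_size_bias[OF e] mean
    using assms by (intro divide_right_mono) auto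
  then have "gen_fun (downshifted_size_bias (mixed_poisson (pareto_law lam \<delta>))) ?e \<le> ?e"
    unfolding fix_e .
  then have le: "?d \<le> ?e"
    by (rule eta_le[OF e])
  \<comment> \<open>First the mixing law is changed at the argument \<open>?d\<close>, then the
    argument is raised to \<open>?e\<close>.\<close>
  have "gen_fun (mixed_poisson (pareto_law lam \<delta>)) ?d \<le> gen_fun (mixed_poisson (pareto_law lam \<epsilon>)) ?d"
    using assms d e le
    by (simp add: E.gen_fun_mixed_poisson D.gen_fun_mixed_poisson pareto_law_exp_mono)
  also have "\<dots> \<le> gen_fun (mixed_poisson (pareto_law lam \<epsilon>)) ?e"
    using d e le by (intro gen_fun_mono)
  finally show ?thesis
    by (simp add: zeta_CM_def)
qed

theorem theorem4p6:
  fixes lam :: real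
  assumes "lam > lambda_cr"
  shows "\<exists>\<alpha>cr::real. \<alpha>cr > 1 \<and> (\<forall>\<alpha> \<beta>. \<alpha>cr \<le> \<alpha> \<and> \<alpha> \<le> \<beta> \<longrightarrow>
           zeta_CM (pareto_mixed_poisson lam \<alpha>) \<le> zeta_CM (pareto_mixed_poisson lam \<beta>) \<and>
           zeta_CM (pareto_mixed_poisson lam \<beta>) \<le> zeta_CM (poisson_pmf lam))"
proof -
  have cr: "0 < lambda_cr" "(1 - exp (- 2)) * lambda_cr = 2"
    by (auto simp: lambda_cr_eq simp del: right_diff_distrib_numeral left_diff_distrib_numeral)
  then have lam: "0 < lam"
    using assms by simp
  \<comment> \<open>The solution of \<open>lam * (1 - 1 / \<alpha>) = lambda_cr\<close>, that is,
    the shape at which the lower end of the Pareto support equals \<open>lambda_cr\<close>.\<close>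
  define \<alpha>cr where "\<alpha>cr = lam / (lam - lambda_cr)"
  have \<alpha>cr: "\<alpha>cr > 1"
    using assms cr by (simp add: \<alpha>cr_def)
  have large: "2 \<le> (1 - exp (- 2)) * (lam * (1 - 1 / \<alpha>))" if "\<alpha>cr \<le> \<alpha>" for \<alpha>
  proof -
    have "lambda_cr = lam * (1 - 1 / \<alpha>cr)"
      using assms lam by (simp add: \<alpha>cr_def field_simps)
    also have "\<dots> \<le> lam * (1 - 1 / \<alpha>)"
      using that \<alpha>cr lam by (intro mult_left_mono diff_left_mono divide_left_mono) auto
    finally have "(1 - exp (- 2)) * lambda_cr \<le> (1 - exp (- 2)) * (lam * (1 - 1 / \<alpha>))"
      by (intro mult_left_mono) auto
    then show ?thesis
      using cr by simp
  qed
  \<comment> \<open>With \<open>\<epsilon> = 1 / \<alpha>\<close> a larger shape means a smaller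
    parameter, and the Poisson law is the endpoint 0; both inequalities are instances of the same
    comparison.\<close>
  have "zeta_CM (pareto_mixed_poisson lam \<alpha>) \<le> zeta_CM (pareto_mixed_poisson lam \<beta>) \<and>
      zeta_CM (pareto_mixed_poisson lam \<beta>) \<le> zeta_CM (poisson_pmf lam)"
    if "\<alpha>cr \<le> \<alpha>" "\<alpha> \<le> \<beta>" for \<alpha> \<beta>
    using zeta_CM_pareto_law_antimono[OF lam, of "1 / \<beta>" "1 / \<alpha>"]
      zeta_CM_pareto_law_antimono[OF lam, of 0 "1 / \<beta>"] large[of \<alpha>] large[of \<beta>] that \<alpha>cr
    by (simp add: pareto_mixed_poisson_eq poisson_eq_mixed_poisson lam frac_le)
  with \<alpha>cr show ?thesis
    by blast
qed

end
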